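(* Assume that the diffusion coefficients are constant, $\sigma_{i,j}(x)\equiv\sigma_{i,j}$ for all $i,j=1,\dots,d$, and that the system of SDEs $$\mathrm{d}X_i(t)=\Big\{\sum_{j\neq i}\frac{\gamma_{i,j}}{X_i(t)-X_j(t)}+b_i(X(t))\Big\}\mathrm{d}t+\sum_{j=1}^d\sigma_{i,j}\,\mathrm{d}W_j(t),\qquad i=1,\dots,d,$$ has a unique strong solution $X$ in $\Delta_d$ on $[0,T]$. Let $X^{(n)}$ be the semi-implicit Euler-Maruyama scheme defined in the context. Then there exists a finite random variable $\eta$ which does not depend on $n$ such that for all integers $n\ge 2$, $$\sup_{k=1,\dots,n}\big|X(t_k^{(n)})-X^{(n)}(t_k^{(n)})\big|\le\frac{\sqrt{\log n}}{\sqrt n}\,\eta\qquad\text{a.s.}$$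
   Context: Let $d\ge 2$, $T>0$, $\Delta_d=\{(x_1,\dots,x_d)^*\in\mathbb{R}^d: x_1<x_2<\cdots<x_d\}$, and let $|\cdot|$ be the Euclidean norm. $W=(W_1,\dots,W_d)^*$ is a $d$-dimensional standard Brownian motion on a probability space $(\Omega,\mathcal F,\mathbb P)$ with a filtration $(\mathcal F_t)_{t\ge0}$ satisfying the usual conditions. Standing assumptions: (A1) $X(0)\in\Delta_d$ almost surely; (A2) $\gamma_{i,j}=\gamma_{j,i}\ge0$ are constants for $i\ne j$, with $\gamma_{i,i+1}>0$ for $i=1,\dots,d-1$; (A3) the functions $b_i:\mathbb{R}^d\to\mathbb{R}$ are globally Lipschitz continuous; (A4) the functions $\sigma_{i,j}:\mathbb{R}^d\to\mathbb{R}$ are globally Lipschitz continuous and bounded. Semi-implicit Euler-Maruyama scheme: for $n\in\mathbb{N}$ put $t_k^{(n)}=kT/n$ and $X^{(n)}(0)=X(0)$; for $k=0,\dots,n-1$, $X^{(n)}(t_{k+1}^{(n)})$ is the unique solution in $\Delta_d$ of the system ($i=1,\dots,d$) $$X_i^{(n)}(t_{k+1}^{(n)})=X_i^{(n)}(t_k^{(n)})+\Big\{\sum_{j\ne i}\frac{\gamma_{i,j}}{X_i^{(n)}(t_{k+1}^{(n)})-X_j^{(n)}(t_{k+1}^{(n)})}+b_i\big(X^{(n)}(t_k^{(n)})\big)\Big\}\frac Tn+\sum_{j=1}^d\sigma_{i,j}\big(X^{(n)}(t_k^{(n)})\big)\big\{W_j(t_{k+1}^{(n)})-W_j(t_k^{(n)})\big\}.$$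 (It is known that this system has exactly one solution in $\Delta_d$.) *)

theory Defs
  imports "HOL-Probability.Probability"
begin

text \<open>
  Vectors of dimension \<open>d\<close> are indexed by a finite linearly ordered type \<open>'d\<close> with
  \<open>CARD('d) = d\<close>; its order plays the role of \<open>1 < 2 < \<dots> < d\<close>.  Time-indexed families
  are functions on \<open>real\<close> of which only the values at times \<open>t \<ge> 0\<close> matter.
\<close>

definition weyl_chamber :: "(real ^ 'd::{finite,linorder}) set" where
  "weyl_chamber = {x. \<forall>i j. i < j \<longrightarrow> x $ i < x $ j}"

definition next_index :: "'d::linorder \<Rightarrow> 'd \<Rightarrow> bool" where
  "next_index i j \<longleftrightarrow> i < j \<and> \<not> (\<exists>k. i < k \<and> k < j)"

definition repulsion_coeffs :: "('d::{finite,linorder} \<Rightarrow> 'd \<Rightarrow> real) \<Rightarrow> bool" where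
  "repulsion_coeffs \<gamma> \<longleftrightarrow>
     (\<forall>i j. i \<noteq> j \<longrightarrow> \<gamma> i j = \<gamma> j i \<and> \<gamma> i j \<ge> 0) \<and>
     (\<forall>i j. next_index i j \<longrightarrow> \<gamma> i j > 0)"

definition drift ::
  "('d::finite \<Rightarrow> 'd \<Rightarrow> real) \<Rightarrow> ('d \<Rightarrow> real ^ 'd \<Rightarrow> real) \<Rightarrow> real ^ 'd \<Rightarrow> real ^ 'd \<Rightarrow> 'd \<Rightarrow> real"
where
  \<comment> \<open>the singular part is evaluated at \<open>y\<close>, the regular part at \<open>x\<close>\<close>
  "drift \<gamma> b y x i = (\<Sum>j\<in>UNIV - {i}. \<gamma> i j / (y $ i - y $ j)) + b i x"

definition usual_filtration :: "'a measure \<Rightarrow> (real \<Rightarrow> 'a measure) \<Rightarrow> bool" where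
  "usual_filtration M F \<longleftrightarrow>
     (\<forall>t\<ge>0. subalgebra M (F t)) \<and>
     (\<forall>s t. 0 \<le> s \<longrightarrow> s \<le> t \<longrightarrow> sets (F s) \<subseteq> sets (F t)) \<and>
     (\<forall>t\<ge>0. sets (F t) = (\<Inter>s\<in>{t<..}. sets (F s))) \<and>
     (\<forall>N\<in>null_sets M. \<forall>A\<subseteq>N. A \<in> sets (F 0))"

definition brownian_motion ::
  "'a measure \<Rightarrow> (real \<Rightarrow> 'a measure) \<Rightarrow> (real \<Rightarrow> 'a \<Rightarrow> real ^ 'd::finite) \<Rightarrow> bool" where
  "brownian_motion M F W \<longleftrightarrow>
     (\<forall>t\<ge>0. W t \<in> borel_measurable (F t)) \<and>
     (AE \<omega> in M. W 0 \<omega> = 0) \<and>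
     (AE \<omega> in M. continuous_on {0..} (\<lambda>t. W t \<omega>)) \<and>
     (\<forall>s t. 0 \<le> s \<longrightarrow> s < t \<longrightarrow>
        prob_space.indep_set M (sets (F s))
          {(\<lambda>\<omega>. W t \<omega> - W s \<omega>) -` A \<inter> space M | A. A \<in> sets borel} \<and>
        distributed M lborel (\<lambda>\<omega>. W t \<omega> - W s \<omega>)
          (\<lambda>x. ennreal (\<Prod>i\<in>UNIV. normal_density 0 (sqrt (t - s)) (x $ i))))"

text \<open>
  Solutions in the Weyl chamber on \<open>[0,T]\<close> of the SDE with constant diffusion matrix
  \<open>\<sigma>\<close>, on the given filtered probability space and driven by the given \<open>W\<close>.  The
  Ito integral of the constant \<open>\<sigma> i j\<close> over \<open>[0,t]\<close> against the \<open>j\<close>-th component of \<open>W\<close>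
  is the increment \<open>\<sigma> i j * (W t \<omega> $ j - W 0 \<omega> $ j)\<close>.
\<close>

definition strong_solution ::
  "'a measure \<Rightarrow> (real \<Rightarrow> 'a measure) \<Rightarrow> (real \<Rightarrow> 'a \<Rightarrow> real ^ 'd::{finite,linorder}) \<Rightarrow> real \<Rightarrow>
   ('d \<Rightarrow> 'd \<Rightarrow> real) \<Rightarrow> ('d \<Rightarrow> real ^ 'd::{finite,linorder} \<Rightarrow> real) \<Rightarrow> ('d \<Rightarrow> 'd \<Rightarrow> real) \<Rightarrow>
   (real \<Rightarrow> 'a \<Rightarrow> real ^ 'd::{finite,linorder}) \<Rightarrow> bool" where
  "strong_solution M F W T \<gamma> b \<sigma> X \<longleftrightarrow>
     (\<forall>t\<in>{0..T}. X t \<in> borel_measurable (F t)) \<and>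
     (AE \<omega> in M. continuous_on {0..T} (\<lambda>t. X t \<omega>) \<and> (\<forall>t\<in>{0..T}. X t \<omega> \<in> weyl_chamber)) \<and>
     (AE \<omega> in M. \<forall>t\<in>{0..T}. \<forall>i.
        set_integrable lborel {0..t} (\<lambda>s. drift \<gamma> b (X s \<omega>) (X s \<omega>) i) \<and>
        X t \<omega> $ i = X 0 \<omega> $ i
          + (LBINT s:{0..t}. drift \<gamma> b (X s \<omega>) (X s \<omega>) i)
          + (\<Sum>j\<in>UNIV. \<sigma> i j * (W t \<omega> $ j - W 0 \<omega> $ j)))"

definition unique_strong_solution ::
  "'a measure \<Rightarrow> (real \<Rightarrow> 'a measure) \<Rightarrow> (real \<Rightarrow> 'a \<Rightarrow> real ^ 'd::{finite,linorder}) \<Rightarrow> real \<Rightarrow>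
   ('d \<Rightarrow> 'd \<Rightarrow> real) \<Rightarrow> ('d \<Rightarrow> real ^ 'd::{finite,linorder} \<Rightarrow> real) \<Rightarrow> ('d \<Rightarrow> 'd \<Rightarrow> real) \<Rightarrow>
   (real \<Rightarrow> 'a \<Rightarrow> real ^ 'd::{finite,linorder}) \<Rightarrow> bool" where
  "unique_strong_solution M F W T \<gamma> b \<sigma> X \<longleftrightarrow>
     strong_solution M F W T \<gamma> b \<sigma> X \<and>
     (\<forall>Y. strong_solution M F W T \<gamma> b \<sigma> Y \<longrightarrow> (AE \<omega> in M. Y 0 \<omega> = X 0 \<omega>) \<longrightarrow>
        (AE \<omega> in M. \<forall>t\<in>{0..T}. Y t \<omega> = X t \<omega>))"

definition grid :: "real \<Rightarrow> nat \<Rightarrow> nat \<Rightarrow> real" where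
  "grid T n k = real k * T / real n"

text \<open>
  \<open>semi_implicit_EM M W T \<gamma> b \<sigma> \<xi> n Z\<close>: the sequence \<open>Z 0, \<dots>, Z n\<close> is the semi-implicit
  Euler-Maruyama scheme with \<open>n\<close> steps started at \<open>\<xi>\<close>; \<open>Z k\<close> is its value at time
  \<open>grid T n k\<close>.  As the implicit equation has exactly one solution in the Weyl chamber, this
  determines \<open>Z 0, \<dots>, Z n\<close> almost surely.
\<close>

definition semi_implicit_EM ::
  "'a measure \<Rightarrow> (real \<Rightarrow> 'a \<Rightarrow> real ^ 'd::{finite,linorder}) \<Rightarrow> real \<Rightarrow>
   ('d \<Rightarrow> 'd \<Rightarrow> real) \<Rightarrow> ('d \<Rightarrow> real ^ 'd::{finite,linorder} \<Rightarrow> real) \<Rightarrow> ('d \<Rightarrow> 'd \<Rightarrow> real ^ 'd::{finite,linorder} \<Rightarrow> real) \<Rightarrow>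
   ('a \<Rightarrow> real ^ 'd::{finite,linorder}) \<Rightarrow> nat \<Rightarrow> (nat \<Rightarrow> 'a \<Rightarrow> real ^ 'd::{finite,linorder}) \<Rightarrow> bool" where
  "semi_implicit_EM M W T \<gamma> b \<sigma> \<xi> n Z \<longleftrightarrow>
     (AE \<omega> in M. Z 0 \<omega> = \<xi> \<omega> \<and>
        (\<forall>k<n. Z (Suc k) \<omega> \<in> weyl_chamber \<and>
          (\<forall>i. Z (Suc k) \<omega> $ i = Z k \<omega> $ i
             + drift \<gamma> b (Z (Suc k) \<omega>) (Z k \<omega>) i * (T / real n)
             + (\<Sum>j\<in>UNIV. \<sigma> i j (Z k \<omega>) *
                  (W (grid T n (Suc k)) \<omega> $ j - W (grid T n k) \<omega> $ j)))))"

end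

theory Submission
  imports Defs
begin

text \<open>
  The noise is additive, so it cancels in the error \<open>e = X - Xn\<close> at grid points, and what is
  left is a deterministic estimate along each path.  The repulsive part of the drift is dissipative on
  the Weyl chamber (\<open>repulsion_dissipative\<close>); since the scheme treats it implicitly, it does
  not increase the error, however close the scheme comes to the boundary.  With a step of
  length \<open>h\<close> the error satisfies \<open>\<bar>e'\<bar> \<le> (1 + L * h) * \<bar>e\<bar> + \<bar>r\<bar>\<close>, where \<open>L\<close> is the Lipschitz constant of
  \<open>b\<close> and the local error \<open>r\<close> is at most \<open>h\<close> times the oscillation of the drift along the exact
  solution over one step.

  The exact solution is continuous on a compact interval and stays in the open chamber, hence its norm is
  bounded and its gaps are bounded below.  There the drift is Lipschitz, so \<open>r\<close> is at most a
  constant times \<open>h\<close> times the oscillation of \<open>X\<close>, which is of the order of \<open>h\<close> plus the oscillation of \<open>W\<close>.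
  Summing over the steps by a discrete Gronwall inequality gives \<open>semi_implicit_euler_error\<close>, and
  the rate is therefore the modulus of continuity of Brownian motion at scale \<open>T / n\<close>, which is
  \<open>sqrt (ln n / n)\<close> up to a random factor.  That modulus follows from almost sure bounds
  on dyadic increments (\<open>brownian_motion_dyadic_increments\<close>) by chaining
  (\<open>oscillation_le_of_dyadic_increments\<close>).

  The scheme need not be measurable in \<open>\<omega>\<close>, so \<open>\<eta>\<close> cannot be defined through the errors themselves.  Instead,
  for every integer \<open>N\<close> there is one constant \<open>c N\<close> valid for all paths whose distance to the boundary,
  norm and dyadic increments are controlled by \<open>N\<close> (\<open>pathwise_convergence_rate\<close>).  The
  least such \<open>N\<close> is a random variable \<open>\<kappa>\<close> that depends on \<open>X\<close> and \<open>W\<close> only, and \<open>\<eta> = c \<kappa>\<close>.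
\<close>

section \<open>The semi-implicit Euler scheme for a dissipative drift\<close>

lemma grid_0 [simp]: "grid T n 0 = 0"
  by (simp add: grid_def)

lemma grid_Suc: "grid T n (Suc k) = grid T n k + T / real n"
  unfolding grid_def add_divide_distrib[symmetric] by (simp add: distrib_right)

lemma grid_mem:
  assumes "0 \<le> T" and "k \<le> n"
  shows "grid T n k \<in> {0..T}"
proof (cases "n = 0")
  case False
  have "real k * T \<le> real n * T" using assms by (intro mult_right_mono) auto
  then have "grid T n k \<le> T"
    unfolding grid_def using False by (subst pos_divide_le_eq) (auto simp: mult.commute)
  then show ?thesis using assms False by (simp add: grid_def)
qed (use assms in \<open>simp add: grid_def\<close>)

text \<open>
  Pairing \<open>e = p + v\<close> with \<open>e\<close> itself drops the implicit part \<open>v\<close>, and Cauchy-Schwarz does the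
  rest.  This is why the singular drift costs nothing in the error recursion: implicit steps
  are nonexpansive whatever the size of \<open>v\<close>.
\<close>
lemma norm_le_of_dissipative_step:
  fixes e p v :: "'b::real_inner"
  assumes "e = p + v" and "e \<bullet> v \<le> 0"
  shows "norm e \<le> norm p"
proof -
  have "norm e * norm e = e \<bullet> p + e \<bullet> v"
    by (metis assms(1) inner_add_right power2_eq_square power2_norm_eq_inner)
  also have "\<dots> \<le> norm e * norm p"
    using assms(2) norm_cauchy_schwarz[of e p] by linarith
  finally show ?thesis
    by (cases "norm e = 0") (auto simp: mult_le_cancel_left)
qed

lemma discrete_gronwall:
  fixes a :: "nat \<Rightarrow> real"
  assumes "a 0 \<le> 0" and "c \<ge> 0" and "r \<ge> 0"
    and step: "\<And>k. k < n \<Longrightarrow> a (Suc k) \<le> (1 + c) * a k + r"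
    and "k \<le> n"
  shows "a k \<le> exp (c * real n) * (real n * r)"
proof -
  have "k \<le> n \<Longrightarrow> a k \<le> (1 + c) ^ k * (real k * r)"
  proof (induction k)
    case (Suc k)
    have "a (Suc k) \<le> (1 + c) * a k + r"
      using step Suc.prems by simp
    also have "\<dots> \<le> (1 + c) * ((1 + c) ^ k * (real k * r)) + (1 + c) ^ Suc k * r"
    proof (intro add_mono mult_left_mono)
      have "1 * r \<le> (1 + c) ^ Suc k * r"
        using assms(2,3) by (intro mult_right_mono one_le_power) auto
      then show "r \<le> (1 + c) ^ Suc k * r" by simp
    qed (use Suc assms(2) in auto)
    finally show ?case by (simp add: algebra_simps)
  qed (use assms(1) in simp)
  also have "(1 + c) ^ k * (real k * r) \<le> exp (c * real n) * (real n * r)"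
  proof (intro mult_mono)
    have "(1 + c) ^ k \<le> (1 + c) ^ n"
      using assms by (intro power_increasing) auto
    also have "\<dots> \<le> exp c ^ n"
      using assms by (intro power_mono exp_ge_add_one_self) auto
    finally show "(1 + c) ^ k \<le> exp (c * real n)"
      by (simp add: exp_of_nat2_mult)
  qed (use assms in auto)
  finally show ?thesis using \<open>k \<le> n\<close> by simp
qed

text \<open>
  The deterministic core.  The path \<open>x\<close> and the scheme \<open>Z\<close> are driven by the same additive
  noise \<open>q\<close>, which cancels in the difference \<open>e\<close>.  Here \<open>f\<close> is the dissipative part,
  treated implicitly; \<open>C\<close> is where it is dissipative and \<open>D\<close> is where it is Lipschitz.  Only the
  exact path has to stay in \<open>D\<close>: the difference \<open>f (x t) - f (Z (Suc k))\<close> is never estimated,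
  only its sign is used.  The remaining local error \<open>r\<close> compares values of the
  coefficients along \<open>x\<close> within one step, hence is governed by the oscillation \<open>\<rho>\<close> of \<open>x\<close>.
\<close>
lemma semi_implicit_euler_error:
  fixes f \<beta> :: "'b::euclidean_space \<Rightarrow> 'b" and x q :: "real \<Rightarrow> 'b"
  assumes "T > 0" and "n \<ge> 1"
    and dissipative: "\<And>y z. y \<in> C \<Longrightarrow> z \<in> C \<Longrightarrow> (y - z) \<bullet> (f y - f z) \<le> 0"
    and "K-lipschitz_on D f" and "L-lipschitz_on UNIV \<beta>" and "D \<subseteq> C"
    and "continuous_on {0..T} x" and xD: "\<And>t. t \<in> {0..T} \<Longrightarrow> x t \<in> D"
    and x_eq: "\<And>t. t \<in> {0..T} \<Longrightarrow> x t = x 0 + integral {0..t} (\<lambda>s. f (x s) + \<beta> (x s)) + q t"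
    and "Z 0 = x 0" and ZC: "\<And>k. k < n \<Longrightarrow> Z (Suc k) \<in> C"
    and Z_eq: "\<And>k. k < n \<Longrightarrow> Z (Suc k) = Z k + (T / real n) *\<^sub>R (f (Z (Suc k)) + \<beta> (Z k))
                 + (q (grid T n (Suc k)) - q (grid T n k))"
    and osc: "\<And>s t. s \<in> {0..T} \<Longrightarrow> t \<in> {0..T} \<Longrightarrow> \<bar>t - s\<bar> \<le> T / real n \<Longrightarrow> norm (x t - x s) \<le> \<rho>"
    and "k \<le> n"
  shows "norm (x (grid T n k) - Z k) \<le> exp (L * T) * (T * ((K + L) * \<rho>))"
proof -
  define h where "h = T / real n"
  have h: "h > 0" "h * real n = T" using assms(1,2) by (auto simp: h_def)
  have K: "K \<ge> 0" and L: "L \<ge> 0" using assms(4,5) by (auto dest: lipschitz_on_nonneg)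
  have \<rho>: "\<rho> \<ge> 0" using osc[of 0 0] assms(1) h by (auto simp: h_def)
  define e where "e k = x (grid T n k) - Z k" for k
  define G where "G s = f (x s) + \<beta> (x s)" for s
  have contG: "continuous_on {0..T} G"
    unfolding G_def
    by (intro continuous_on_add continuous_on_compose2[OF lipschitz_on_continuous_on[OF assms(4)]]
        continuous_on_compose2[OF lipschitz_on_continuous_on[OF assms(5)]] assms(7)) (use xD in auto)
  have step: "norm (e (Suc k)) \<le> (1 + h * L) * norm (e k) + h * ((K + L) * \<rho>)" if k: "k < n" for k
  proof -
    define s t where "s = grid T n k" and "t = grid T n (Suc k)"
    have st: "t = s + h" by (simp add: s_def t_def h_def grid_Suc)
    have s: "s \<in> {0..T}" and t: "t \<in> {0..T}"
      using grid_mem[of T k n] grid_mem[of T "Suc k" n] k assms(1) by (auto simp: s_def t_def)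
    have Gint: "G integrable_on {0..t}" "G integrable_on {s..t}"
      using s t by (auto intro!: integrable_continuous_interval continuous_on_subset[OF contG])
    have "integral {0..t} G = integral {0..s} G + integral {s..t} G"
      using s t st h Gint by (subst Henstock_Kurzweil_Integration.integral_combine) auto
    then have dx: "x t = x s + integral {s..t} G + (q t - q s)"
      using x_eq[OF s] x_eq[OF t] unfolding G_def[symmetric] by simp
    define r where "r = integral {s..t} (\<lambda>u. G u - (f (x t) + \<beta> (x s)))"
    have r_eq: "integral {s..t} G = h *\<^sub>R (f (x t) + \<beta> (x s)) + r"
      unfolding r_def using Gint st h by (subst integral_diff) auto
    have "norm r \<le> (K + L) * \<rho> * (t - s)"
      unfolding r_def
    proof (rule integral_bound)
      show "continuous_on {s..t} (\<lambda>u. G u - (f (x t) + \<beta> (x s)))"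
        using s t by (intro continuous_intros continuous_on_subset[OF contG]) auto
    next
      fix u assume u: "u \<in> {s..t}"
      then have uT: "u \<in> {0..T}" using s t by auto
      have "norm (G u - (f (x t) + \<beta> (x s))) \<le> norm (f (x u) - f (x t)) + norm (\<beta> (x u) - \<beta> (x s))"
        unfolding G_def by (metis add_diff_add norm_triangle_ineq)
      also have "norm (f (x u) - f (x t)) \<le> K * norm (x u - x t)"
        using lipschitz_onD[OF assms(4) xD[OF uT] xD[OF t]] by (simp add: dist_norm)
      also have "norm (x u - x t) \<le> \<rho>"
        using osc[OF t uT] u st by (simp add: h_def)
      also have "norm (\<beta> (x u) - \<beta> (x s)) \<le> L * norm (x u - x s)"
        using lipschitz_onD[OF assms(5), of "x u" "x s"] by (simp add: dist_norm)
      also have "norm (x u - x s) \<le> \<rho>"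
        using osc[OF s uT] u st by (simp add: h_def)
      finally show "norm (G u - (f (x t) + \<beta> (x s))) \<le> (K + L) * \<rho>"
        using K L by (simp add: distrib_right mult_left_mono)
    qed (use st h in auto)
    then have r: "norm r \<le> h * ((K + L) * \<rho>)" using st by (simp add: mult.commute)
    \<comment> \<open>The last summand is the implicit part, which dissipativity removes.\<close>
    have "e (Suc k) = (e k + h *\<^sub>R (\<beta> (x s) - \<beta> (Z k)) + r) + h *\<^sub>R (f (x t) - f (Z (Suc k)))"
    proof -
      have xt: "x t = x s + (h *\<^sub>R (f (x t) + \<beta> (x s)) + r) + (q t - q s)"
        using dx r_eq by simp
      have zt: "Z (Suc k) = Z k + h *\<^sub>R (f (Z (Suc k)) + \<beta> (Z k)) + (q t - q s)"
        using Z_eq[OF k] by (simp add: s_def t_def h_def)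
      have "x t - Z (Suc k) = (x s + (h *\<^sub>R (f (x t) + \<beta> (x s)) + r) + (q t - q s))
          - (Z k + h *\<^sub>R (f (Z (Suc k)) + \<beta> (Z k)) + (q t - q s))"
        by (rule arg_cong2[OF xt zt, of minus])
      then show ?thesis
        by (simp add: e_def s_def[symmetric] t_def[symmetric] algebra_simps)
    qed
    moreover have "e (Suc k) \<bullet> (h *\<^sub>R (f (x t) - f (Z (Suc k)))) \<le> 0"
      using dissipative[of "x t" "Z (Suc k)"] xD[OF t] ZC[OF k] assms(6) h
      by (auto simp: e_def t_def mult_le_0_iff)
    ultimately have "norm (e (Suc k)) \<le> norm (e k + h *\<^sub>R (\<beta> (x s) - \<beta> (Z k)) + r)"
      by (rule norm_le_of_dissipative_step)
    also have "\<dots> \<le> norm (e k) + h * norm (\<beta> (x s) - \<beta> (Z k)) + norm r"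
      using h by (intro order_trans[OF norm_triangle_ineq] add_mono) (auto intro: norm_triangle_le)
    also have "norm (\<beta> (x s) - \<beta> (Z k)) \<le> L * norm (e k)"
      using lipschitz_onD[OF assms(5), of "x s" "Z k"] by (simp add: dist_norm e_def s_def)
    finally show ?thesis using r h by (simp add: algebra_simps)
  qed
  have "norm (e k) \<le> exp (h * L * real n) * (real n * (h * ((K + L) * \<rho>)))"
    by (rule discrete_gronwall[where a = "\<lambda>k. norm (e k)" and n = n])
      (use step h K L \<rho> \<open>Z 0 = x 0\<close> \<open>k \<le> n\<close> in \<open>simp_all add: e_def\<close>)
  moreover have "h * L * real n = L * T" by (simp add: mult_ac flip: h(2))
  moreover have "real n * (h * ((K + L) * \<rho>)) = T * ((K + L) * \<rho>)" by (simp add: mult_ac flip: h(2))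
  ultimately show ?thesis unfolding e_def by simp
qed

lemma norm_diff_le_of_integral_equation:
  fixes x :: "real \<Rightarrow> 'b::euclidean_space"
  assumes cont: "continuous_on {0..T} (\<lambda>s. G (x s))"
    and B: "\<And>s. s \<in> {0..T} \<Longrightarrow> norm (G (x s)) \<le> B"
    and eq: "\<And>t. t \<in> {0..T} \<Longrightarrow> x t = x 0 + integral {0..t} (\<lambda>s. G (x s)) + q t"
    and "s \<in> {0..T}" and "t \<in> {0..T}"
  shows "norm (x t - x s) \<le> B * \<bar>t - s\<bar> + norm (q t - q s)"
proof -
  have *: "norm (x t - x s) \<le> B * (t - s) + norm (q t - q s)" if s: "s \<in> {0..T}" and t: "t \<in> {0..T}" and "s \<le> t" for s t
  proof -
    have "(\<lambda>u. G (x u)) integrable_on {0..t}"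
      using t by (auto intro!: integrable_continuous_interval continuous_on_subset[OF cont])
    then have "integral {0..t} (\<lambda>u. G (x u)) = integral {0..s} (\<lambda>u. G (x u)) + integral {s..t} (\<lambda>u. G (x u))"
      using that by (subst Henstock_Kurzweil_Integration.integral_combine) auto
    then have "x t - x s = integral {s..t} (\<lambda>u. G (x u)) + (q t - q s)"
      unfolding eq[OF s] eq[OF t] by simp
    moreover have "norm (integral {s..t} (\<lambda>u. G (x u))) \<le> B * (t - s)"
      using that by (intro integral_bound continuous_on_subset[OF cont] B) auto
    ultimately show ?thesis
      using norm_triangle_ineq[of "integral {s..t} (\<lambda>u. G (x u))" "q t - q s"] by simp
  qed
  show ?thesis
    using *[of s t] *[of t s] assms(4,5) by (cases "s \<le> t") (auto simp: norm_minus_commute)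
qed

section \<open>The repulsive drift in the Weyl chamber\<close>

definition repulsion :: "('d::finite \<Rightarrow> 'd \<Rightarrow> real) \<Rightarrow> real ^ 'd \<Rightarrow> real ^ 'd" where
  "repulsion \<gamma> x = (\<chi> i. \<Sum>j\<in>UNIV - {i}. \<gamma> i j / (x $ i - x $ j))"

text \<open>
  An exhaustion of the Weyl chamber by compact sets on which the repulsion is Lipschitz.
  Indexing by natural numbers with one parameter for both bounds lets a single random
  integer record how close a path comes to the boundary.
\<close>
definition well_separated :: "nat \<Rightarrow> (real ^ 'd::{finite,linorder}) set" where
  "well_separated N = {x. norm x \<le> real N \<and> (\<forall>i j. i < j \<longrightarrow> 1 \<le> real N * (x $ j - x $ i))}"

lemma well_separated_subset_weyl_chamber: "well_separated N \<subseteq> weyl_chamber"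
proof
  fix x :: "real ^ 'd::{finite,linorder}" assume x: "x \<in> well_separated N"
  show "x \<in> weyl_chamber" unfolding weyl_chamber_def
  proof safe
    fix i j :: 'd assume "i < j"
    then have "1 \<le> real N * (x $ j - x $ i)" using x by (auto simp: well_separated_def)
    then have "0 < real N * (x $ j - x $ i)" by linarith
    then show "x $ i < x $ j" by (simp add: zero_less_mult_iff)
  qed
qed

lemma closed_well_separated: "closed (well_separated N :: (real ^ 'd::{finite,linorder}) set)"
proof -
  have "well_separated N = {x :: real ^ 'd::{finite,linorder}. norm x \<le> real N} \<inter>
      (\<Inter>i. \<Inter>j\<in>{i<..}. {x. 1 \<le> real N * (x $ j - x $ i)})"
    by (auto simp: well_separated_def)
  then show ?thesis
    by (simp only:) (intro closed_Int closed_INT ballI closed_Collect_le continuous_intros)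
qed

lemma well_separated_mono:
  assumes "N \<le> N'"
  shows "well_separated N \<subseteq> (well_separated N' :: (real ^ 'd::{finite,linorder}) set)"
proof
  fix x :: "real ^ 'd::{finite,linorder}" assume x: "x \<in> well_separated N"
  have "1 \<le> real N' * (x $ j - x $ i)" if "i < j" for i j
  proof -
    have "x $ i < x $ j"
      using x that well_separated_subset_weyl_chamber[of N] by (force simp: weyl_chamber_def)
    then have "real N * (x $ j - x $ i) \<le> real N' * (x $ j - x $ i)"
      using assms by (intro mult_right_mono) auto
    then show ?thesis using x that by (force simp: well_separated_def)
  qed
  then show "x \<in> well_separated N'" using x assms by (auto simp: well_separated_def)
qed

text \<open>
  Each gap is continuous and positive on \<open>A\<close>, so its reciprocal is bounded there.
\<close>
lemma compact_subset_well_separated: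
  fixes A :: "(real ^ 'd::{finite,linorder}) set"
  assumes "compact A" and "A \<subseteq> weyl_chamber"
  shows "\<exists>N. A \<subseteq> well_separated N"
proof -
  define g where "g p x = 1 / (x $ snd p - x $ fst p)" for p :: "'d \<times> 'd" and x :: "real ^ 'd::{finite,linorder}"
  have "\<exists>B. \<forall>x\<in>A. \<bar>g p x\<bar> \<le> B" if "fst p < snd p" for p
  proof -
    have "x $ snd p - x $ fst p \<noteq> 0" if "x \<in> A" for x
      using assms(2) that \<open>fst p < snd p\<close> by (force simp: weyl_chamber_def)
    then have "continuous_on A (g p)" unfolding g_def by (intro continuous_intros) auto
    then show ?thesis
      using compact_imp_bounded[OF compact_continuous_image[OF _ assms(1)]]
      by (fastforce simp: bounded_iff)
  qed
  then obtain B where B: "\<And>p x. fst p < snd p \<Longrightarrow> x \<in> A \<Longrightarrow> \<bar>g p x\<bar> \<le> B p"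
    by metis
  obtain R where R: "\<And>x. x \<in> A \<Longrightarrow> norm x \<le> R"
    using compact_imp_bounded[OF assms(1)] by (auto simp: bounded_iff)
  obtain N :: nat where N: "\<bar>R\<bar> + (\<Sum>p\<in>UNIV. \<bar>B p\<bar>) \<le> real N"
    using real_arch_simple by blast
  have Bs: "\<bar>B p\<bar> \<le> (\<Sum>p\<in>UNIV. \<bar>B p\<bar>)" for p
    by (rule member_le_sum) auto
  have "x \<in> well_separated N" if x: "x \<in> A" for x
  proof -
    have "norm x \<le> real N"
    proof -
      have "0 \<le> (\<Sum>p\<in>UNIV. \<bar>B p\<bar>)" by (intro sum_nonneg) simp
      then show ?thesis using R[OF x] N by linarith
    qed
    moreover have "1 \<le> real N * (x $ j - x $ i)" if ij: "i < j" for i j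
    proof -
      have pos: "x $ j - x $ i > 0" using assms(2) x ij by (force simp: weyl_chamber_def)
      have "1 / (x $ j - x $ i) \<le> real N"
        using B[of "(i, j)" x] Bs[of "(i, j)"] ij x N pos by (simp add: g_def)
      then show ?thesis using pos by (simp add: divide_le_eq)
    qed
    ultimately show ?thesis by (simp add: well_separated_def)
  qed
  then show ?thesis by blast
qed

text \<open>
  The repulsion is minus the gradient of a convex function on the chamber.  The proof
  symmetrises the double sum in \<open>i\<close> and \<open>j\<close>: as \<open>\<gamma>\<close> is symmetric, every pair contributes
  a nonnegative multiple of \<open>(p - q) * (1 / p - 1 / q) = - (p - q)\<^sup>2 / (p * q)\<close>, where
  the gaps \<open>p\<close> of \<open>x\<close> and \<open>q\<close> of \<open>y\<close> have the same sign.
\<close>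
lemma repulsion_dissipative:
  assumes \<gamma>: "repulsion_coeffs \<gamma>" and x: "x \<in> weyl_chamber" and y: "y \<in> weyl_chamber"
  shows "(x - y) \<bullet> (repulsion \<gamma> x - repulsion \<gamma> y) \<le> 0"
proof -
  \<comment> \<open>The diagonal is set to zero so that the sums may range over all indices.\<close>
  define a where "a i j = (if i = j then 0 else \<gamma> i j * (1 / (x $ i - x $ j) - 1 / (y $ i - y $ j)))" for i j
  define u where "u = x - y"
  have rep: "(repulsion \<gamma> x - repulsion \<gamma> y) $ i = (\<Sum>j\<in>UNIV. a i j)" for i
  proof -
    have "(repulsion \<gamma> x - repulsion \<gamma> y) $ i = (\<Sum>j\<in>UNIV - {i}. a i j)"
      by (auto simp: repulsion_def a_def sum_subtractf[symmetric] right_diff_distrib intro!: sum.cong)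
    also have "\<dots> = (\<Sum>j\<in>UNIV. a i j)"
      by (intro sum.mono_neutral_left) (auto simp: a_def)
    finally show ?thesis .
  qed
  have anti: "a j i = - a i j" for i j
  proof (cases "i = j")
    case False
    have "1 / (x $ j - x $ i) = - (1 / (x $ i - x $ j))" "1 / (y $ j - y $ i) = - (1 / (y $ i - y $ j))"
      by (metis minus_diff_eq minus_divide_right)+
    moreover have "\<gamma> j i = \<gamma> i j" using \<gamma> False by (auto simp: repulsion_coeffs_def)
    ultimately show ?thesis using False by (simp add: a_def algebra_simps)
  qed (simp add: a_def)
  have "(\<Sum>i\<in>UNIV. \<Sum>j\<in>UNIV. u $ i * a i j) = (\<Sum>j\<in>UNIV. \<Sum>i\<in>UNIV. u $ i * a i j)"
    by (rule sum.swap)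
  also have "\<dots> = - (\<Sum>i\<in>UNIV. \<Sum>j\<in>UNIV. u $ j * a i j)"
    unfolding sum_negf[symmetric] by (intro sum.cong refl) (subst anti, simp)
  finally have "2 * (\<Sum>i\<in>UNIV. \<Sum>j\<in>UNIV. u $ i * a i j) = (\<Sum>i\<in>UNIV. \<Sum>j\<in>UNIV. (u $ i - u $ j) * a i j)"
    by (simp add: left_diff_distrib sum_subtractf)
  also have "\<dots> \<le> 0"
  proof (intro sum_nonpos)
    fix i j
    show "(u $ i - u $ j) * a i j \<le> 0"
    proof (cases "i = j")
      case False
      define p q where "p = x $ i - x $ j" and "q = y $ i - y $ j"
      have pq: "p * q > 0"
        using False x y unfolding p_def q_def weyl_chamber_def
        by (cases "i < j") (auto intro: mult_neg_neg mult_pos_pos dest!: not_less[THEN iffD1] order.not_eq_order_implies_strict)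
      then have "p \<noteq> 0" "q \<noteq> 0" by auto
      then have "(p - q) * (1 / p - 1 / q) = - ((p - q)\<^sup>2 / (p * q))"
        by (simp add: field_simps power2_eq_square)
      also have "\<dots> \<le> 0" using pq by simp
      finally have "\<gamma> i j * ((p - q) * (1 / p - 1 / q)) \<le> 0"
        using \<gamma> False by (auto simp: repulsion_coeffs_def intro: mult_nonneg_nonpos)
      then show ?thesis using False by (simp add: a_def u_def p_def q_def algebra_simps)
    qed (simp add: a_def)
  qed
  finally show ?thesis
    by (simp add: inner_vec_def rep u_def[symmetric] sum_distrib_left[symmetric] del: vector_minus_component)
qed

lemma lipschitz_on_vec:
  fixes f :: "'b::metric_space \<Rightarrow> real ^ 'd::finite"
  assumes "\<And>i. \<exists>C. C-lipschitz_on A (\<lambda>x. f x $ i)"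
  shows "\<exists>C. C-lipschitz_on A f"
proof -
  obtain C where C: "\<And>i. (C i)-lipschitz_on A (\<lambda>x. f x $ i)" using assms by metis
  have "(\<Sum>i\<in>UNIV. C i)-lipschitz_on A f"
  proof (rule lipschitz_onI)
    fix x y assume "x \<in> A" "y \<in> A"
    have "dist (f x) (f y) \<le> (\<Sum>i\<in>UNIV. \<bar>(f x - f y) $ i\<bar>)"
      unfolding dist_norm by (rule norm_le_l1_cart)
    also have "\<dots> \<le> (\<Sum>i\<in>UNIV. C i * dist x y)"
      using lipschitz_onD[OF C \<open>x \<in> A\<close> \<open>y \<in> A\<close>] by (intro sum_mono) (simp add: dist_real_def)
    finally show "dist (f x) (f y) \<le> (\<Sum>i\<in>UNIV. C i) * dist x y" by (simp add: sum_distrib_right)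
  qed (use C in \<open>auto intro!: sum_nonneg dest: lipschitz_on_nonneg\<close>)
  then show ?thesis ..
qed

text \<open>
  By \<open>1 / p - 1 / q = (q - p) / (p * q)\<close>: gaps of size at least \<open>1 / N\<close> cost a factor \<open>N\<^sup>2\<close>.
\<close>
lemma repulsion_lipschitz_on_well_separated:
  fixes \<gamma> :: "'d::{finite,linorder} \<Rightarrow> 'd \<Rightarrow> real"
  shows "\<exists>K. K-lipschitz_on (well_separated N) (repulsion \<gamma>)"
proof (rule lipschitz_on_vec)
  fix i :: 'd
  have "\<exists>C. C-lipschitz_on (well_separated N) (\<lambda>x. \<gamma> i j / (x $ i - x $ j))" if "j \<noteq> i" for j
  proof
    show "(2 * \<bar>\<gamma> i j\<bar> * (real N)\<^sup>2)-lipschitz_on (well_separated N) (\<lambda>x. \<gamma> i j / (x $ i - x $ j))"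
    proof (rule lipschitz_onI)
      fix x y :: "real ^ 'd::{finite,linorder}" assume x: "x \<in> well_separated N" and y: "y \<in> well_separated N"
      define p q where "p = x $ i - x $ j" and "q = y $ i - y $ j"
      have gap: "1 \<le> real N * \<bar>z $ i - z $ j\<bar>" if "z \<in> well_separated N" for z
      proof -
        have *: "1 \<le> real N * (z $ m - z $ l)" if "l < m" for l m
          using \<open>z \<in> well_separated N\<close> that by (auto simp: well_separated_def)
        show ?thesis
        proof (cases "i < j")
          case True
          have "real N * (z $ j - z $ i) \<le> real N * \<bar>z $ i - z $ j\<bar>"
            by (intro mult_left_mono) auto
          then show ?thesis using *[OF True] by linarith
        next
          case False
          have "real N * (z $ i - z $ j) \<le> real N * \<bar>z $ i - z $ j\<bar>"
            by (intro mult_left_mono) auto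
          then show ?thesis using *[of j i] False \<open>j \<noteq> i\<close> by force
        qed
      qed
      have pq: "1 \<le> real N * \<bar>p\<bar>" "1 \<le> real N * \<bar>q\<bar>" using gap x y by (auto simp: p_def q_def)
      then have nz: "p \<noteq> 0" "q \<noteq> 0" by auto
      have "1 * 1 \<le> (real N * \<bar>p\<bar>) * (real N * \<bar>q\<bar>)" using pq by (intro mult_mono) auto
      then have inv: "1 / \<bar>p * q\<bar> \<le> (real N)\<^sup>2"
        using nz by (simp add: divide_le_eq power2_eq_square abs_mult mult_ac)
      have comp: "\<bar>(x - y) $ l\<bar> \<le> dist x y" for l unfolding dist_norm by (rule component_le_norm_cart)
      have "\<gamma> i j / p - \<gamma> i j / q = \<gamma> i j * (q - p) * (1 / (p * q))"
        using nz by (simp add: field_simps)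
      then have "dist (\<gamma> i j / p) (\<gamma> i j / q) = \<bar>\<gamma> i j\<bar> * \<bar>q - p\<bar> * (1 / \<bar>p * q\<bar>)"
        by (simp add: dist_real_def abs_mult)
      also have "\<dots> \<le> \<bar>\<gamma> i j\<bar> * (2 * dist x y) * (real N)\<^sup>2"
        using comp[of i] comp[of j] inv by (intro mult_mono) (auto simp: p_def q_def)
      finally show "dist (\<gamma> i j / (x $ i - x $ j)) (\<gamma> i j / (y $ i - y $ j))
          \<le> 2 * \<bar>\<gamma> i j\<bar> * (real N)\<^sup>2 * dist x y" by (simp add: p_def q_def mult_ac)
    qed auto
  qed
  then obtain C where C: "\<And>j. j \<noteq> i \<Longrightarrow> (C j)-lipschitz_on (well_separated N) (\<lambda>x. \<gamma> i j / (x $ i - x $ j))"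
    by metis
  have "(\<Sum>j\<in>UNIV - {i}. C j)-lipschitz_on (well_separated N) (\<lambda>x. repulsion \<gamma> x $ i)"
  proof (rule lipschitz_onI)
    fix x y :: "real ^ 'd::{finite,linorder}" assume x: "x \<in> well_separated N" and y: "y \<in> well_separated N"
    have "dist (repulsion \<gamma> x $ i) (repulsion \<gamma> y $ i)
       \<le> (\<Sum>j\<in>UNIV - {i}. dist (\<gamma> i j / (x $ i - x $ j)) (\<gamma> i j / (y $ i - y $ j)))"
      by (simp add: repulsion_def dist_real_def sum_subtractf[symmetric] sum_abs)
    also have "\<dots> \<le> (\<Sum>j\<in>UNIV - {i}. C j * dist x y)"
      using lipschitz_onD[OF C x y] by (intro sum_mono) auto
    finally show "dist (repulsion \<gamma> x $ i) (repulsion \<gamma> y $ i) \<le> (\<Sum>j\<in>UNIV - {i}. C j) * dist x y"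
      by (simp add: sum_distrib_right)
  qed (use C in \<open>auto intro!: sum_nonneg dest: lipschitz_on_nonneg\<close>)
  then show "\<exists>C. C-lipschitz_on (well_separated N) (\<lambda>x. repulsion \<gamma> x $ i)" ..
qed

section \<open>From dyadic increments to the modulus of continuity\<close>

definition dyadic_floor :: "real \<Rightarrow> nat \<Rightarrow> real \<Rightarrow> nat" where
  "dyadic_floor T m t = nat \<lfloor>t * 2 ^ m / T\<rfloor>"

lemma dyadic_floor_le: "T > 0 \<Longrightarrow> t \<in> {0..T} \<Longrightarrow> dyadic_floor T m t \<le> 2 ^ m"
proof -
  assume T: "T > 0" and t: "t \<in> {0..T}"
  have "t * 2 ^ m / T \<le> 2 ^ m" using T t by (simp add: divide_le_eq)
  then have "\<lfloor>t * 2 ^ m / T\<rfloor> \<le> \<lfloor>2 ^ m :: real\<rfloor>" by (rule floor_mono)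
  also have "\<lfloor>2 ^ m :: real\<rfloor> = 2 ^ m" by (metis floor_of_int of_int_numeral of_int_power)
  finally show ?thesis by (simp add: dyadic_floor_def nat_le_iff)
qed

lemma real_dyadic_floor: "T > 0 \<Longrightarrow> t \<ge> 0 \<Longrightarrow> real (dyadic_floor T m t) = of_int \<lfloor>t * 2 ^ m / T\<rfloor>"
  by (simp add: dyadic_floor_def)

lemma grid_dyadic_floor_bounds:
  assumes "T > 0" and "t \<ge> 0"
  shows "grid T (2 ^ m) (dyadic_floor T m t) \<le> t"
    and "t < grid T (2 ^ m) (dyadic_floor T m t) + T / 2 ^ m"
proof -
  have "real (dyadic_floor T m t) \<le> t * 2 ^ m / T" "t * 2 ^ m / T < real (dyadic_floor T m t) + 1"
    by (simp_all add: real_dyadic_floor[OF assms])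
  then show "grid T (2 ^ m) (dyadic_floor T m t) \<le> t"
    "t < grid T (2 ^ m) (dyadic_floor T m t) + T / 2 ^ m"
    using assms(1) by (simp_all add: grid_def field_simps)
qed

lemma grid_dyadic_floor_tendsto:
  assumes "T > 0" and "t \<ge> 0"
  shows "(\<lambda>m. grid T (2 ^ m) (dyadic_floor T m t)) \<longlonglongrightarrow> t"
proof (rule tendsto_sandwich[of "\<lambda>m. t - T / 2 ^ m" _ _ "\<lambda>m. t"])
  have "(\<lambda>m. t - T * (1 / 2) ^ m) \<longlonglongrightarrow> t - T * 0"
    by (intro tendsto_intros LIMSEQ_realpow_zero) auto
  then show "(\<lambda>m. t - T / 2 ^ m) \<longlonglongrightarrow> t" by (simp add: power_one_over)
qed (use grid_dyadic_floor_bounds[OF assms] in \<open>auto intro!: always_eventually simp: algebra_simps less_imp_le\<close>)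

lemma grid_double: "grid T (2 ^ Suc m) (2 * k) = grid T (2 ^ m) k"
  by (simp add: grid_def)

lemma dyadic_floor_Suc:
  assumes "T > 0" and "t \<ge> 0"
  shows "dyadic_floor T (Suc m) t \<in> {2 * dyadic_floor T m t, Suc (2 * dyadic_floor T m t)}"
proof -
  define y where "y = t * 2 ^ m / T"
  have y: "y \<ge> 0" "t * 2 ^ Suc m / T = 2 * y" using assms by (auto simp: y_def)
  have "\<lfloor>2 * y\<rfloor> = 2 * \<lfloor>y\<rfloor> \<or> \<lfloor>2 * y\<rfloor> = 2 * \<lfloor>y\<rfloor> + 1" by linarith
  moreover have "\<lfloor>y\<rfloor> \<ge> 0" using y by simp
  moreover have "nat (2 * f) = 2 * nat f" "nat (2 * f + 1) = Suc (2 * nat f)" if "f \<ge> 0" for f :: int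
    using that by arith+
  ultimately show ?thesis
    unfolding dyadic_floor_def y(2) y_def[symmetric] by (metis insertCI)
qed

lemma path_in_closed_of_dyadic:
  fixes x :: "real \<Rightarrow> 'b::t1_space"
  assumes T: "T > 0" and "closed A" and cont: "continuous_on {0..T} x"
    and grid: "\<And>m k. k \<le> 2 ^ m \<Longrightarrow> x (grid T (2 ^ m) k) \<in> A" and t: "t \<in> {0..T}"
  shows "x t \<in> A"
proof (rule Lim_in_closed_set[OF \<open>closed A\<close>])
  show "(\<lambda>m. x (grid T (2 ^ m) (dyadic_floor T m t))) \<longlonglongrightarrow> x t"
    using grid_mem[of T _ "2 ^ _"] dyadic_floor_le[OF T t] T t
    by (intro continuous_on_tendsto_compose[OF cont grid_dyadic_floor_tendsto]) auto
qed (use grid dyadic_floor_le[OF T t] in auto)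

text \<open>
  Levy's chaining.  Rounding \<open>u\<close> down to the dyadic grids of levels \<open>m\<close>, \<open>m + 1\<close>, \<dots> gives
  points \<open>p j u\<close> that converge to \<open>w u\<close>, and consecutive ones are equal or differ by one
  increment of the finer level.  At level \<open>m\<close> the roundings of \<open>s\<close> and \<open>t\<close> are at most one
  increment apart.
\<close>
lemma norm_diff_le_chaining:
  fixes w :: "real \<Rightarrow> 'b::real_normed_vector"
  assumes T: "T > 0" and cont: "continuous_on {0..T} w"
    and incr: "\<And>j k. m \<le> j \<Longrightarrow> k < 2 ^ j \<Longrightarrow> norm (w (grid T (2 ^ j) (Suc k)) - w (grid T (2 ^ j) k)) \<le> a j"
    and a: "(\<lambda>i. a (m + i)) sums A"
    and s: "s \<in> {0..T}" and t: "t \<in> {0..T}" and st: "\<bar>t - s\<bar> \<le> T / 2 ^ m"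
  shows "norm (w t - w s) \<le> 2 * A"
proof -
  define p where "p j u = w (grid T (2 ^ j) (dyadic_floor T j u))" for j u
  have a0: "a j \<ge> 0" if "m \<le> j" for j
    using order_trans[OF norm_ge_zero incr[OF that, of 0]] by simp
  have p_step: "norm (p (Suc j) u - p j u) \<le> a (Suc j)" if u: "u \<in> {0..T}" and j: "m \<le> j" for j u
  proof -
    have "dyadic_floor T (Suc j) u \<le> 2 ^ Suc j" using dyadic_floor_le[OF T u] .
    then show ?thesis
      using dyadic_floor_Suc[of T u j] T u incr[of "Suc j" "2 * dyadic_floor T j u"] j a0[of "Suc j"]
      by (auto simp: p_def grid_double simp del: power_Suc)
  qed
  have p_sum: "norm (p (m + i) u - p m u) \<le> (\<Sum>l<i. a (m + Suc l))" if u: "u \<in> {0..T}" for i u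
  proof (induction i)
    case (Suc i)
    have "norm (p (m + Suc i) u - p m u) \<le> norm (p (Suc (m + i)) u - p (m + i) u) + norm (p (m + i) u - p m u)"
      by (metis add_Suc_right diff_add_cancel norm_triangle_ineq add_diff_eq)
    then show ?case using Suc p_step[OF u, of "m + i"] by simp
  qed simp
  have tail: "(\<lambda>i. a (m + Suc i)) sums (A - a m)"
    using a by (subst sums_Suc_iff[of "\<lambda>i. a (m + i)"]) simp
  have p_lim: "norm (w u - p m u) \<le> A - a m" if u: "u \<in> {0..T}" for u
  proof (rule LIMSEQ_le_const2)
    have mem: "grid T (2 ^ j) (dyadic_floor T j u) \<in> {0..T}" for j
      using grid_mem[of T "dyadic_floor T j u" "2 ^ j"] dyadic_floor_le[OF T u] T by simp
    have "(\<lambda>j. p j u) \<longlonglongrightarrow> w u"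
      unfolding p_def
      by (rule continuous_on_tendsto_compose[OF cont grid_dyadic_floor_tendsto])
        (use T u mem in auto)
    then have "(\<lambda>i. p (i + m) u) \<longlonglongrightarrow> w u" by (rule LIMSEQ_ignore_initial_segment)
    then show "(\<lambda>i. norm (p (m + i) u - p m u)) \<longlonglongrightarrow> norm (w u - p m u)"
      by (intro tendsto_intros) (simp add: add.commute)
    have "(\<Sum>l<i. a (m + Suc l)) \<le> A - a m" for i
      using sum_le_suminf[OF sums_summable[OF tail], of "{..<i}"] sums_unique[OF tail] a0 by auto
    then show "\<exists>N. \<forall>i\<ge>N. norm (p (m + i) u - p m u) \<le> A - a m"
      using p_sum[OF u] order_trans by blast
  qed
  have coarse: "norm (p m v - p m u) \<le> a m"
    if uv: "u \<in> {0..T}" "v \<in> {0..T}" "u \<le> v" "v - u \<le> T / 2 ^ m" for u v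
  proof -
    have "v * 2 ^ m / T \<le> u * 2 ^ m / T + 1" using uv T by (simp add: field_simps)
    moreover have "u * 2 ^ m / T \<le> v * 2 ^ m / T" using uv T by (simp add: divide_right_mono)
    ultimately have "\<lfloor>v * 2 ^ m / T\<rfloor> = \<lfloor>u * 2 ^ m / T\<rfloor> \<or> \<lfloor>v * 2 ^ m / T\<rfloor> = \<lfloor>u * 2 ^ m / T\<rfloor> + 1" by linarith
    moreover have "\<lfloor>u * 2 ^ m / T\<rfloor> \<ge> 0" using uv T by simp
    moreover have "nat (f + 1) = Suc (nat f)" if "f \<ge> 0" for f :: int using that by arith
    ultimately have "dyadic_floor T m v = dyadic_floor T m u \<or> dyadic_floor T m v = Suc (dyadic_floor T m u)"
      unfolding dyadic_floor_def by metis
    then show ?thesis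
      using dyadic_floor_le[OF T uv(2), of m] incr[of m "dyadic_floor T m u"] a0[of m]
      by (auto simp: p_def)
  qed
  have "norm (p m t - p m s) \<le> a m"
    using coarse[OF s t] coarse[OF t s] st by (cases "s \<le> t") (auto simp: norm_minus_commute)
  moreover have "norm (w t - w s) \<le> norm (w t - p m t) + norm (p m t - p m s) + norm (p m s - w s)"
    by (smt (verit, ccfv_threshold) diff_add_cancel add_diff_eq norm_triangle_ineq)
  moreover have "norm (p m s - w s) \<le> A - a m"
    using p_lim[OF s] by (simp add: norm_minus_commute)
  ultimately show ?thesis using p_lim[OF t] a0[of m] by linarith
qed

text \<open>
  The level bounds \<open>sqrt (j / 2 ^ j)\<close> that hold for Brownian increments are dominated from level
  \<open>m\<close> on by a geometric sequence whose constant does not depend on \<open>m\<close>; Bernoulli's inequality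
  \<open>1 + i / 3 \<le> (4 / 3) ^ i\<close> trades the linear factor for a slightly larger ratio.
\<close>
lemma sqrt_dyadic_tail:
  assumes "m \<ge> 1"
  shows "sqrt (real (m + i) / 2 ^ (m + i)) \<le> sqrt (real m / 2 ^ m) * (sqrt 3 * sqrt (2 / 3) ^ i)"
proof -
  have "1 + real i * (1/3) \<le> (1 + 1/3) ^ i"
    using Bernoulli_inequality[of "1/3 :: real" i] by (simp add: mult.commute)
  moreover have "real (m + i) \<le> real m * (1 + real i)"
    using assms by (simp add: distrib_left mult_le_cancel_right1)
  ultimately have "real (m + i) \<le> real m * (3 * (4 / 3) ^ i)"
    using assms by (elim order_trans) (intro mult_left_mono; simp)
  then have "real (m + i) / 2 ^ (m + i) \<le> real m * (3 * (4 / 3) ^ i) / 2 ^ (m + i)"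
    by (intro divide_right_mono) auto
  also have "\<dots> = real m / 2 ^ m * (3 * (2 / 3) ^ i)"
  proof -
    have "(4 / 3 :: real) ^ i / 2 ^ i = (2 / 3) ^ i"
      unfolding power_divide[symmetric] by simp
    moreover have "real m * (3 * (4 / 3) ^ i) / 2 ^ (m + i) = real m / 2 ^ m * (3 * ((4 / 3) ^ i / 2 ^ i))"
      unfolding power_add by simp
    ultimately show ?thesis by (simp only:)
  qed
  finally have "sqrt (real (m + i) / 2 ^ (m + i)) \<le> sqrt (real m / 2 ^ m * (3 * (2 / 3) ^ i))"
    by (rule real_sqrt_le_mono)
  then show ?thesis by (simp only: real_sqrt_mult real_sqrt_power)
qed

text \<open>
  The logarithm in the rate comes from here: for \<open>2 ^ m \<le> n < 2 ^ (m + 1)\<close> chaining bounds the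
  oscillation over a step of length \<open>T / n\<close> by a multiple of \<open>sqrt (m / 2 ^ m)\<close>, where \<open>m\<close> is of the
  order of \<open>ln n\<close>.  In the constant, \<open>sqrt 3 / (1 - sqrt (2 / 3))\<close> is the sum of the geometric sequence from
  \<open>sqrt_dyadic_tail\<close>, and \<open>2 / ln 2\<close> comes from \<open>m \<le> ln n / ln 2\<close> and \<open>1 / 2 ^ m \<le> 2 / n\<close>.
\<close>
lemma oscillation_le_of_dyadic_increments:
  fixes w :: "real \<Rightarrow> 'b::real_normed_vector"
  assumes T: "T > 0" and cont: "continuous_on {0..T} w" and N: "N \<ge> 0"
    and incr: "\<And>j k. 1 \<le> j \<Longrightarrow> k < 2 ^ j \<Longrightarrow>
      norm (w (grid T (2 ^ j) (Suc k)) - w (grid T (2 ^ j) k)) \<le> N * sqrt (real j / 2 ^ j)"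
    and n: "n \<ge> 2" and s: "s \<in> {0..T}" and t: "t \<in> {0..T}" and st: "\<bar>t - s\<bar> \<le> T / real n"
  shows "norm (w t - w s)
    \<le> 2 * (N * (sqrt 3 / (1 - sqrt (2 / 3)) * sqrt (2 / ln 2))) * (sqrt (ln (real n)) / sqrt (real n))"
proof -
  obtain m where m: "2 ^ m \<le> n" "n < 2 ^ (m + 1)"
    using ex_power_ivl1[of 2 n] n by auto
  have m1: "m \<ge> 1"
    using m n by (cases m) auto
  have mn: "2 ^ m \<le> real n" "real n \<le> 2 * 2 ^ m"
    using m of_nat_mono[of "2 ^ m" n, where ?'a = real] of_nat_mono[of n "2 * 2 ^ m", where ?'a = real] by auto
  define a where "a j = N * (sqrt (real m / 2 ^ m) * (sqrt 3 * sqrt (2 / 3) ^ (j - m)))" for j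
  define A where "A = N * (sqrt (real m / 2 ^ m) * (sqrt 3 * (1 / (1 - sqrt (2 / 3)))))"
  have "norm (w t - w s) \<le> 2 * A"
  proof (rule norm_diff_le_chaining[OF T cont _ _ s t])
    fix j k :: nat assume j: "m \<le> j" and k: "k < 2 ^ j"
    have "norm (w (grid T (2 ^ j) (Suc k)) - w (grid T (2 ^ j) k)) \<le> N * sqrt (real j / 2 ^ j)"
      using incr j k m1 by simp
    also have "\<dots> \<le> a j"
      unfolding a_def using sqrt_dyadic_tail[OF m1, of "j - m"] j N by (intro mult_left_mono) auto
    finally show "norm (w (grid T (2 ^ j) (Suc k)) - w (grid T (2 ^ j) k)) \<le> a j" .
  next
    show "(\<lambda>i. a (m + i)) sums A"
      unfolding a_def A_def add_diff_cancel_left' by (intro sums_mult geometric_sums) auto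
  next
    show "\<bar>t - s\<bar> \<le> T / 2 ^ m"
    proof -
      have "T / real n \<le> T / 2 ^ m" using mn T n by (intro divide_left_mono) auto
      then show ?thesis using st by linarith
    qed
  qed
  also have "A \<le> N * ((sqrt (2 / ln 2) * (sqrt (ln (real n)) / sqrt (real n))) * (sqrt 3 * (1 / (1 - sqrt (2 / 3)))))"
    unfolding A_def
  proof (intro mult_left_mono mult_right_mono N)
    have "real m * ln 2 = ln (2 ^ m)" by (simp add: ln_realpow)
    also have "\<dots> \<le> ln (real n)" using mn n by (subst ln_le_cancel_iff) auto
    finally have "real m \<le> ln (real n) / ln 2" by (simp add: pos_le_divide_eq)
    moreover have "1 / 2 ^ m \<le> 2 / real n" using mn n by (simp add: field_simps)
    ultimately have "real m * (1 / 2 ^ m) \<le> ln (real n) / ln 2 * (2 / real n)"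
      using n by (intro mult_mono) auto
    then have "sqrt (real m / 2 ^ m) \<le> sqrt (2 / ln 2 * (ln (real n) / real n))"
      by (intro real_sqrt_le_mono) (simp add: mult_ac)
    then show "sqrt (real m / 2 ^ m) \<le> sqrt (2 / ln 2) * (sqrt (ln (real n)) / sqrt (real n))"
      by (simp only: real_sqrt_mult real_sqrt_divide)
  qed auto
  finally show ?thesis by (simp add: mult_ac)
qed

lemma inverse_le_rate:
  assumes "n \<ge> 2"
  shows "1 / real n \<le> 1 / sqrt (ln 2) * (sqrt (ln (real n)) / sqrt (real n))"
proof -
  have "1 / real n \<le> 1 / sqrt (real n)"
    using assms by (intro divide_left_mono) (auto simp: real_le_lsqrt power2_eq_square)
  also have "1 \<le> sqrt (ln (real n)) / sqrt (ln 2)" using assms by simp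
  then have "1 / sqrt (real n) \<le> (sqrt (ln (real n)) / sqrt (ln 2)) / sqrt (real n)"
    by (rule divide_right_mono) simp
  finally show ?thesis by simp
qed

section \<open>Dyadic increments of Brownian motion\<close>

text \<open>
  Multiplying the Gaussian density of variance \<open>h\<close> by \<open>exp (\<bar>x\<bar>\<^sup>2 / (4 * h))\<close> gives, up to the
  factor \<open>sqrt 2\<close> per coordinate, the Gaussian density of variance \<open>2 * h\<close>.  The latter
  integrates to one because it is the density of an increment over a time interval of twice the length.
\<close>
lemma brownian_motion_exp_sq_increment:
  fixes W :: "real \<Rightarrow> 'a \<Rightarrow> real ^ 'd::finite"
  assumes M: "prob_space M" and W: "brownian_motion M F W" and st: "0 \<le> s" "s < t"
  shows "(\<integral>\<^sup>+ \<omega>. ennreal (exp ((norm (W t \<omega> - W s \<omega>))\<^sup>2 / (4 * (t - s)))) \<partial>M) = ennreal (sqrt 2 ^ CARD('d))"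
proof -
  define h where "h = t - s"
  have h: "h > 0" using st by (simp add: h_def)
  define \<phi> where "\<phi> v x = (\<Prod>i\<in>UNIV. normal_density 0 (sqrt v) (x $ i))" for v and x :: "real ^ 'd"
  have D: "distributed M lborel (\<lambda>\<omega>. W t' \<omega> - W s \<omega>) (\<lambda>x. ennreal (\<phi> (t' - s) x))" if "s < t'" for t'
    using W st that by (auto simp: brownian_motion_def \<phi>_def)
  have "(\<integral>\<^sup>+ x. ennreal (\<phi> (2 * h) x) * 1 \<partial>lborel) = (\<integral>\<^sup>+ \<omega>. 1 \<partial>M)"
    using distributed_nn_integral[OF D[of "s + 2 * h"], of "\<lambda>_. 1"] h by simp
  then have one: "(\<integral>\<^sup>+ x. ennreal (\<phi> (2 * h) x) \<partial>lborel) = 1"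
    using prob_space.emeasure_space_1[OF M] by simp
  have scale: "normal_density 0 (sqrt h) y * exp (y\<^sup>2 / (4 * h)) = sqrt 2 * normal_density 0 (sqrt (2 * h)) y" for y
  proof -
    have "exp (- (y\<^sup>2 / (2 * h))) * exp (y\<^sup>2 / (4 * h)) = exp (- (y\<^sup>2 / (4 * h)))"
      using h by (simp add: field_simps flip: exp_add)
    then show ?thesis
      using h by (simp add: normal_density_def real_sqrt_mult field_simps)
  qed
  have density: "\<phi> h x * exp ((norm x)\<^sup>2 / (4 * h)) = sqrt 2 ^ CARD('d) * \<phi> (2 * h) x" for x
  proof -
    have "exp ((norm x)\<^sup>2 / (4 * h)) = (\<Prod>i\<in>UNIV. exp ((x $ i)\<^sup>2 / (4 * h)))"
      by (simp add: norm_vec_def L2_set_def sum_nonneg sum_divide_distrib exp_sum)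
    then have "\<phi> h x * exp ((norm x)\<^sup>2 / (4 * h)) = (\<Prod>i\<in>UNIV. normal_density 0 (sqrt h) (x $ i) * exp ((x $ i)\<^sup>2 / (4 * h)))"
      by (simp add: \<phi>_def prod.distrib)
    then show ?thesis by (simp only: scale prod.distrib) (simp add: \<phi>_def)
  qed
  have \<phi>_nonneg: "\<phi> v x \<ge> 0" for v x by (auto simp: \<phi>_def intro!: prod_nonneg)
  have "(\<integral>\<^sup>+ \<omega>. ennreal (exp ((norm (W t \<omega> - W s \<omega>))\<^sup>2 / (4 * h))) \<partial>M)
      = (\<integral>\<^sup>+ x. ennreal (\<phi> h x) * ennreal (exp ((norm x)\<^sup>2 / (4 * h))) \<partial>lborel)"
    using distributed_nn_integral[OF D[of t], of "\<lambda>x. ennreal (exp ((norm x)\<^sup>2 / (4 * h)))"] st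
    by (simp add: h_def)
  also have "\<dots> = (\<integral>\<^sup>+ x. ennreal (sqrt 2 ^ CARD('d)) * ennreal (\<phi> (2 * h) x) \<partial>lborel)"
    using \<phi>_nonneg by (intro nn_integral_cong) (simp add: density flip: ennreal_mult)
  also have "\<dots> = ennreal (sqrt 2 ^ CARD('d))"
    using distributed_borel_measurable[OF D[of "s + 2 * h"]] h one by (subst nn_integral_cmult) auto
  finally show ?thesis by (simp add: h_def)
qed

text \<open>
  All dyadic increments are controlled at once by one series: the exponential moments of the
  \<open>2 ^ m\<close> increments of level \<open>m\<close>, weighted by \<open>4 ^ (- m)\<close>, have a finite total expectation, so their sum
  \<open>S\<close> is almost surely finite.  Since every term is below \<open>S\<close>, taking logarithms shows
  that \<open>2 ^ m\<close> times the squared norm of an increment of level \<open>m\<close> is at most a random multiple of \<open>m\<close>.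
\<close>
lemma brownian_motion_dyadic_increments:
  fixes W :: "real \<Rightarrow> 'a \<Rightarrow> real ^ 'd::finite"
  assumes M: "prob_space M" and W: "brownian_motion M F W" and T: "T > 0"
    and meas: "\<And>t. t \<ge> 0 \<Longrightarrow> W t \<in> borel_measurable M"
  shows "AE \<omega> in M. \<exists>N::nat. \<forall>m\<ge>1. \<forall>k<2 ^ m.
    norm (W (grid T (2 ^ m) (Suc k)) \<omega> - W (grid T (2 ^ m) k) \<omega>) \<le> real N * sqrt (real m / 2 ^ m)"
proof -
  define \<Delta> where "\<Delta> m k \<omega> = W (grid T (2 ^ m) (Suc k)) \<omega> - W (grid T (2 ^ m) k) \<omega>" for m k \<omega>
  define E where "E m k \<omega> = exp ((norm (\<Delta> m k \<omega>))\<^sup>2 / (4 * (T / 2 ^ m)))" for m k \<omega>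
  define S where "S \<omega> = (\<Sum>m. \<Sum>k<2 ^ m. ennreal (E m k \<omega>) * ennreal ((1 / 4) ^ m))" for \<omega>
  have grid_nonneg: "grid T n k \<ge> 0" for n k using T by (simp add: grid_def)
  have [measurable]: "\<Delta> m k \<in> borel_measurable M" for m k
    unfolding \<Delta>_def by (intro borel_measurable_diff meas grid_nonneg)
  have [measurable]: "E m k \<in> borel_measurable M" for m k
    unfolding E_def by measurable
  have E_int: "(\<integral>\<^sup>+ \<omega>. ennreal (E m k \<omega>) \<partial>M) = ennreal (sqrt 2 ^ CARD('d))" for m k
  proof -
    have "grid T (2 ^ m) (Suc k) - grid T (2 ^ m) k = T / 2 ^ m"
      by (simp add: grid_def field_simps)
    then show ?thesis
      using brownian_motion_exp_sq_increment[OF M W grid_nonneg, of "2 ^ m" k "grid T (2 ^ m) (Suc k)"] T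
      by (simp add: E_def \<Delta>_def grid_def field_simps)
  qed
  have "(\<integral>\<^sup>+ \<omega>. S \<omega> \<partial>M) = (\<Sum>m. \<Sum>k<(2::nat) ^ m. ennreal (sqrt 2 ^ CARD('d)) * ennreal ((1 / 4) ^ m))"
    unfolding S_def by (subst nn_integral_suminf) (auto simp: nn_integral_sum nn_integral_multc E_int)
  also have "\<dots> = (\<Sum>m. ennreal (sqrt 2 ^ CARD('d) * (1 / 2) ^ m))"
  proof (intro suminf_cong)
    fix m
    have "(\<Sum>k<(2::nat) ^ m. sqrt 2 ^ CARD('d) * (1 / 4) ^ m) = sqrt 2 ^ CARD('d) * (1 / 2) ^ m"
      by (simp add: power_mult_distrib[symmetric] mult_ac)
    then show "(\<Sum>k<(2::nat) ^ m. ennreal (sqrt 2 ^ CARD('d)) * ennreal ((1 / 4) ^ m)) = ennreal (sqrt 2 ^ CARD('d) * (1 / 2) ^ m)"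
      by (simp add: ennreal_mult[symmetric] sum_ennreal del: sum_constant)
  qed
  also have "\<dots> < \<infinity>"
    by (subst suminf_ennreal2) (auto intro!: summable_mult summable_geometric)
  finally have "AE \<omega> in M. S \<omega> \<noteq> \<infinity>"
    by (intro nn_integral_noteq_infinite) (auto simp: S_def)
  then show ?thesis
  proof eventually_elim
    case (elim \<omega>)
    \<comment> \<open>The maximum makes \<open>ln R\<close> nonnegative, so that \<open>ln R \<le> m * ln R\<close> for \<open>m \<ge> 1\<close>.\<close>
    define R where "R = max 1 (enn2real (S \<omega>))"
    have "S \<omega> = ennreal (enn2real (S \<omega>))" using elim by (simp add: ennreal_enn2real_if)
    also have "\<dots> \<le> ennreal R" by (rule ennreal_leI) (simp add: R_def)
    finally have S_le: "S \<omega> \<le> ennreal R" .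
    have key: "norm (\<Delta> m k \<omega>) \<le> sqrt (4 * T * (ln 4 + ln R)) * sqrt (real m / 2 ^ m)"
      if m: "m \<ge> 1" and k: "k < 2 ^ m" for m k
    proof -
      have "ennreal (E m k \<omega> * (1 / 4) ^ m) = ennreal (E m k \<omega>) * ennreal ((1 / 4) ^ m)"
        by (simp add: ennreal_mult E_def)
      also have "\<dots> \<le> (\<Sum>k<2 ^ m. ennreal (E m k \<omega>) * ennreal ((1 / 4) ^ m))"
        using k by (intro member_le_sum) auto
      also have "\<dots> \<le> S \<omega>"
        unfolding S_def using sum_le_suminf[of "\<lambda>m. \<Sum>k<2 ^ m. ennreal (E m k \<omega>) * ennreal ((1 / 4) ^ m)" "{m}"]
        by simp
      also note S_le
      finally have "E m k \<omega> * (1 / 4) ^ m \<le> R" by (simp add: R_def)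
      then have "E m k \<omega> \<le> 4 ^ m * R" by (simp add: power_one_over field_simps)
      then have "ln (E m k \<omega>) \<le> ln (4 ^ m * R)" by (subst ln_le_cancel_iff) (auto simp: E_def R_def)
      moreover have "R > 0" by (simp add: R_def)
      ultimately have "(norm (\<Delta> m k \<omega>))\<^sup>2 / (4 * (T / 2 ^ m)) \<le> real m * ln 4 + ln R"
        by (simp add: E_def ln_mult ln_realpow)
      also have "\<dots> \<le> real m * (ln 4 + ln R)"
        using m ln_ge_zero[of R] by (simp add: distrib_left R_def mult_le_cancel_right1)
      finally have "(norm (\<Delta> m k \<omega>))\<^sup>2 \<le> (4 * T * (ln 4 + ln R)) * (real m / 2 ^ m)"
        using T by (simp add: field_simps)
      then show ?thesis by (metis real_le_rsqrt real_sqrt_mult)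
    qed
    obtain N :: nat where "sqrt (4 * T * (ln 4 + ln R)) \<le> real N" using real_arch_simple by blast
    then have "norm (\<Delta> m k \<omega>) \<le> real N * sqrt (real m / 2 ^ m)" if "m \<ge> 1" "k < 2 ^ m" for m k
      using key[OF that] by (elim order_trans mult_right_mono) auto
    then show ?case unfolding \<Delta>_def by blast
  qed
qed

section \<open>The convergence rate\<close>

definition regular_drift :: "('d::finite \<Rightarrow> real ^ 'd \<Rightarrow> real) \<Rightarrow> real ^ 'd \<Rightarrow> real ^ 'd" where
  "regular_drift b x = (\<chi> i. b i x)"

lemma drift_eq: "drift \<gamma> b y x i = (repulsion \<gamma> y + regular_drift b x) $ i"
  by (simp add: drift_def repulsion_def regular_drift_def)

lemma sde_vector_form:
  fixes x w :: "real \<Rightarrow> real ^ 'd::{finite,linorder}"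
  assumes "\<And>i. set_integrable lborel {0..t} (\<lambda>s. drift \<gamma> b (x s) (x s) i)"
    and "\<And>i. x t $ i = x 0 $ i + (LBINT s:{0..t}. drift \<gamma> b (x s) (x s) i)
          + (\<Sum>j\<in>UNIV. \<sigma> i j * (w t $ j - w 0 $ j))"
  shows "x t = x 0 + integral {0..t} (\<lambda>s. repulsion \<gamma> (x s) + regular_drift b (x s))
          + (\<chi> i j. \<sigma> i j) *v (w t - w 0)"
proof -
  define I where "I = (\<chi> i. LBINT s:{0..t}. drift \<gamma> b (x s) (x s) i)"
  have "((\<lambda>s. repulsion \<gamma> (x s) + regular_drift b (x s)) has_integral I) {0..t}"
  proof (subst has_integral_componentwise_iff, safe)
    fix v :: "real ^ 'd::{finite,linorder}" assume "v \<in> Basis"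
    then obtain i where v: "v = axis i 1" by (auto simp: Basis_vec_def)
    have "((\<lambda>s. drift \<gamma> b (x s) (x s) i) has_integral (LBINT s:{0..t}. drift \<gamma> b (x s) (x s) i)) {0..t}"
      using set_borel_integral_eq_integral[OF assms(1)[of i]] by (metis integrable_integral)
    then show "((\<lambda>s. (repulsion \<gamma> (x s) + regular_drift b (x s)) \<bullet> v) has_integral I \<bullet> v) {0..t}"
      by (simp add: v inner_axis I_def drift_eq)
  qed
  then have "integral {0..t} (\<lambda>s. repulsion \<gamma> (x s) + regular_drift b (x s)) = I" by blast
  then show ?thesis
    using assms(2) by (simp add: vec_eq_iff I_def matrix_vector_mult_def)
qed

text \<open>
  The constant \<open>c\<close> serves all paths \<open>x\<close>, drivers \<open>w\<close>, schemes \<open>Z\<close> and step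
  numbers \<open>n\<close> simultaneously, as soon as \<open>x\<close> and \<open>w\<close> are controlled by the integer \<open>N\<close>.  This uniformity turns a
  measurable choice of \<open>N\<close> into a measurable random constant.
\<close>
definition convergence_constant ::
  "real \<Rightarrow> ('d::{finite,linorder} \<Rightarrow> 'd \<Rightarrow> real) \<Rightarrow> ('d \<Rightarrow> real ^ 'd::{finite,linorder} \<Rightarrow> real) \<Rightarrow> ('d \<Rightarrow> 'd \<Rightarrow> real) \<Rightarrow>
   nat \<Rightarrow> real \<Rightarrow> bool" where
  "convergence_constant T \<gamma> b \<sigma> N c \<longleftrightarrow> (\<forall>x w Z n.
    continuous_on {0..T} x \<longrightarrow> (\<forall>t\<in>{0..T}. x t \<in> well_separated N) \<longrightarrow>
    continuous_on {0..T} w \<longrightarrow>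
    (\<forall>m\<ge>1. \<forall>k<2 ^ m. norm (w (grid T (2 ^ m) (Suc k)) - w (grid T (2 ^ m) k)) \<le> real N * sqrt (real m / 2 ^ m)) \<longrightarrow>
    (\<forall>t\<in>{0..T}. x t = x 0 + integral {0..t} (\<lambda>s. repulsion \<gamma> (x s) + regular_drift b (x s))
        + (\<chi> i j. \<sigma> i j) *v (w t - w 0)) \<longrightarrow>
    n \<ge> 2 \<longrightarrow> Z 0 = x 0 \<longrightarrow>
    (\<forall>k<n. Z (Suc k) \<in> weyl_chamber \<and>
      Z (Suc k) = Z k + (T / real n) *\<^sub>R (repulsion \<gamma> (Z (Suc k)) + regular_drift b (Z k))
        + (\<chi> i j. \<sigma> i j) *v (w (grid T n (Suc k)) - w (grid T n k))) \<longrightarrow>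
    (\<forall>k\<le>n. norm (x (grid T n k) - Z k) \<le> sqrt (ln (real n)) / sqrt (real n) * c))"

lemma convergence_constantD:
  assumes "convergence_constant T \<gamma> b \<sigma> N c"
    and "continuous_on {0..T} x" and "\<forall>t\<in>{0..T}. x t \<in> well_separated N" and "continuous_on {0..T} w"
    and "\<forall>m\<ge>1. \<forall>k<2 ^ m. norm (w (grid T (2 ^ m) (Suc k)) - w (grid T (2 ^ m) k)) \<le> real N * sqrt (real m / 2 ^ m)"
    and "\<forall>t\<in>{0..T}. x t = x 0 + integral {0..t} (\<lambda>s. repulsion \<gamma> (x s) + regular_drift b (x s))
        + (\<chi> i j. \<sigma> i j) *v (w t - w 0)"
    and "n \<ge> 2" and "Z 0 = x 0"
    and "\<forall>k<n. Z (Suc k) \<in> weyl_chamber \<and>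
      Z (Suc k) = Z k + (T / real n) *\<^sub>R (repulsion \<gamma> (Z (Suc k)) + regular_drift b (Z k))
        + (\<chi> i j. \<sigma> i j) *v (w (grid T n (Suc k)) - w (grid T n k))"
  shows "\<forall>k\<le>n. norm (x (grid T n k) - Z k) \<le> sqrt (ln (real n)) / sqrt (real n) * c"
  using assms unfolding convergence_constant_def by blast

text \<open>
  On \<open>well_separated N\<close> the drift is bounded by some \<open>B\<close>, so that over one step \<open>x\<close> moves by at most
  \<open>B * T / n\<close> plus the contribution of the driver.  Both are at most a multiple of the rate, and \<open>\<rho>\<close>
  is the sum of the two factors.
\<close>
lemma pathwise_convergence_rate:
  fixes \<gamma> \<sigma> :: "'d::{finite,linorder} \<Rightarrow> 'd \<Rightarrow> real"
    and b :: "'d \<Rightarrow> real ^ 'd::{finite,linorder} \<Rightarrow> real"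
  assumes T: "T > 0" and \<gamma>: "repulsion_coeffs \<gamma>" and b: "\<And>i. \<exists>L. L-lipschitz_on UNIV (b i)"
  shows "\<exists>c. convergence_constant T \<gamma> b \<sigma> N c"
proof -
  define S where "S = (\<chi> i j. \<sigma> i j)"
  define G where "G y = repulsion \<gamma> y + regular_drift b y" for y
  obtain K where K: "K-lipschitz_on (well_separated N) (repulsion \<gamma>)"
    using repulsion_lipschitz_on_well_separated by blast
  obtain L where L: "L-lipschitz_on UNIV (regular_drift b)"
    using lipschitz_on_vec[of UNIV "regular_drift b"] b by (auto simp: regular_drift_def)
  have contG: "continuous_on (well_separated N) G"
    unfolding G_def
    by (intro continuous_on_add lipschitz_on_continuous_on[OF K]
        continuous_on_subset[OF lipschitz_on_continuous_on[OF L]]) auto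
  have "bounded (well_separated N :: (real ^ 'd::{finite,linorder}) set)"
    unfolding bounded_iff by (auto simp: well_separated_def)
  then have "compact (well_separated N :: (real ^ 'd::{finite,linorder}) set)"
    using closed_well_separated by (simp add: compact_eq_bounded_closed)
  then obtain B where B: "B > 0" "\<And>y. y \<in> well_separated N \<Longrightarrow> norm (G y) \<le> B"
    using compact_imp_bounded[OF compact_continuous_image[OF contG]] by (auto simp: bounded_pos)
  obtain s where s: "s > 0" "\<And>v. norm (S *v v) \<le> norm v * s"
    using bounded_linear.pos_bounded[OF matrix_vector_mul_bounded_linear[of S]] by blast
  define \<rho> where "\<rho> = B * T * (1 / sqrt (ln 2)) + 2 * (real N * (sqrt 3 / (1 - sqrt (2 / 3)) * sqrt (2 / ln 2))) * s"
  have "norm (x (grid T n k) - Z k) \<le> sqrt (ln (real n)) / sqrt (real n) * (exp (L * T) * (T * ((K + L) * \<rho>)))"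
    if x: "continuous_on {0..T} x" "\<forall>t\<in>{0..T}. x t \<in> well_separated N"
      and w: "continuous_on {0..T} w"
        "\<forall>m\<ge>1. \<forall>k<2 ^ m. norm (w (grid T (2 ^ m) (Suc k)) - w (grid T (2 ^ m) k)) \<le> real N * sqrt (real m / 2 ^ m)"
      and eq: "\<forall>t\<in>{0..T}. x t = x 0 + integral {0..t} (\<lambda>s. repulsion \<gamma> (x s) + regular_drift b (x s)) + S *v (w t - w 0)"
      and n: "n \<ge> 2" and Z: "Z 0 = x 0"
        "\<forall>k<n. Z (Suc k) \<in> weyl_chamber \<and>
          Z (Suc k) = Z k + (T / real n) *\<^sub>R (repulsion \<gamma> (Z (Suc k)) + regular_drift b (Z k))
            + S *v (w (grid T n (Suc k)) - w (grid T n k))"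
      and k: "k \<le> n"
    for x w Z n k
  proof -
    define rate where "rate = sqrt (ln (real n)) / sqrt (real n)"
    define q where "q t = S *v (w t - w 0)" for t
    have q_diff: "q t - q r = S *v (w t - w r)" for t r
      by (simp add: q_def matrix_vector_mult_diff_distrib)
    have eq': "x t = x 0 + integral {0..t} (\<lambda>s. G (x s)) + q t" if "t \<in> {0..T}" for t
      unfolding G_def q_def by (rule eq[rule_format, OF that])
    have contGx: "continuous_on {0..T} (\<lambda>s. G (x s))"
      using x by (intro continuous_on_compose2[OF contG x(1)]) auto
    have "norm (x t - x r) \<le> rate * \<rho>" if r: "r \<in> {0..T}" and t: "t \<in> {0..T}" and rt: "\<bar>t - r\<bar> \<le> T / real n" for r t
    proof -
      have "norm (x t - x r) \<le> B * \<bar>t - r\<bar> + norm (q t - q r)"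
        by (rule norm_diff_le_of_integral_equation[where G = G and x = x, OF contGx _ eq' r t])
          (use x B(2) in auto)
      also have "B * \<bar>t - r\<bar> \<le> B * (T * (1 / sqrt (ln 2) * rate))"
      proof (intro mult_left_mono)
        have "T / real n = T * (1 / real n)" by simp
        also have "\<dots> \<le> T * (1 / sqrt (ln 2) * rate)"
          unfolding rate_def using T by (intro mult_left_mono inverse_le_rate n) auto
        finally show "\<bar>t - r\<bar> \<le> T * (1 / sqrt (ln 2) * rate)" using rt by linarith
      qed (use B in simp)
      also have "norm (q t - q r) \<le> norm (w t - w r) * s" unfolding q_diff by (rule s)
      also have "norm (w t - w r) \<le> 2 * (real N * (sqrt 3 / (1 - sqrt (2 / 3)) * sqrt (2 / ln 2))) * rate"
        unfolding rate_def
        by (rule oscillation_le_of_dyadic_increments[OF T w(1) _ _ n r t rt]) (use w in auto)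
      finally show ?thesis using s(1) by (simp add: \<rho>_def algebra_simps)
    qed
    then have "norm (x (grid T n k) - Z k) \<le> exp (L * T) * (T * ((K + L) * (rate * \<rho>)))"
    proof (intro semi_implicit_euler_error[where C = weyl_chamber and q = q and x = x and Z = Z and n = n, OF T _ _ K L well_separated_subset_weyl_chamber x(1) _ eq'[unfolded G_def] Z(1)])
      fix j assume "j < n"
      then show "Z (Suc j) = Z j + (T / real n) *\<^sub>R (repulsion \<gamma> (Z (Suc j)) + regular_drift b (Z j))
          + (q (grid T n (Suc j)) - q (grid T n j))"
        unfolding q_diff using Z(2) by blast
    qed (use n k x(2) Z(2) in \<open>auto intro: repulsion_dissipative[OF \<gamma>]\<close>)
    then show ?thesis by (simp add: rate_def mult_ac)
  qed
  then show ?thesis unfolding S_def convergence_constant_def by blast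
qed

theorem theorem2p5:
  fixes M :: "'a measure" and F :: "real \<Rightarrow> 'a measure"
    and W X :: "real \<Rightarrow> 'a \<Rightarrow> real ^ 'd::{finite,linorder}"
    and T :: real
    and \<gamma> \<sigma> :: "'d \<Rightarrow> 'd \<Rightarrow> real"
    and b :: "'d \<Rightarrow> real ^ 'd::{finite,linorder} \<Rightarrow> real"
    and Xn :: "nat \<Rightarrow> nat \<Rightarrow> 'a \<Rightarrow> real ^ 'd::{finite,linorder}"
  assumes "CARD('d) \<ge> 2" and "T > 0"
    and "prob_space M" and "usual_filtration M F" and "brownian_motion M F W"
    and "AE \<omega> in M. X 0 \<omega> \<in> weyl_chamber"
    and "repulsion_coeffs \<gamma>"
    and "\<And>i. \<exists>L. L-lipschitz_on UNIV (b i)"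
    and "unique_strong_solution M F W T \<gamma> b \<sigma> X"
    and "\<And>n. n \<ge> 1 \<Longrightarrow> semi_implicit_EM M W T \<gamma> b (\<lambda>i j x. \<sigma> i j) (X 0) n (Xn n)"
  shows "\<exists>\<eta> :: 'a \<Rightarrow> real. \<eta> \<in> borel_measurable M \<and>
    (\<forall>n\<ge>2. AE \<omega> in M.
       (SUP k\<in>{1..n}. norm (X (grid T n k) \<omega> - Xn n k \<omega>))
         \<le> sqrt (ln (real n)) / sqrt (real n) * \<eta> \<omega>)"
proof -
  note T = \<open>T > 0\<close>
  have sol: "strong_solution M F W T \<gamma> b \<sigma> X"
    using assms(9) by (simp add: unique_strong_solution_def)
  have subalg: "subalgebra M (F t)" if "t \<ge> 0" for t
    using assms(4) that by (simp add: usual_filtration_def)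
  have W_meas: "W t \<in> borel_measurable M" if "t \<ge> 0" for t
    using assms(5) that by (intro measurable_from_subalg[OF subalg]) (auto simp: brownian_motion_def)
  have X_meas: "X t \<in> borel_measurable M" if "t \<in> {0..T}" for t
    using sol that by (intro measurable_from_subalg[OF subalg]) (auto simp: strong_solution_def)
  have W_cont: "AE \<omega> in M. continuous_on {0..T} (\<lambda>t. W t \<omega>)"
  proof -
    have "AE \<omega> in M. continuous_on {0..} (\<lambda>t. W t \<omega>)"
      using assms(5) by (simp add: brownian_motion_def)
    then show ?thesis by eventually_elim (auto intro: continuous_on_subset)
  qed
  have X_cont: "AE \<omega> in M. continuous_on {0..T} (\<lambda>t. X t \<omega>) \<and> (\<forall>t\<in>{0..T}. X t \<omega> \<in> weyl_chamber)"
    using sol by (simp add: strong_solution_def)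
  have X_eq: "AE \<omega> in M. \<forall>t\<in>{0..T}. X t \<omega> = X 0 \<omega>
      + integral {0..t} (\<lambda>s. repulsion \<gamma> (X s \<omega>) + regular_drift b (X s \<omega>)) + (\<chi> i j. \<sigma> i j) *v (W t \<omega> - W 0 \<omega>)"
  proof -
    have "AE \<omega> in M. \<forall>t\<in>{0..T}. \<forall>i.
        set_integrable lborel {0..t} (\<lambda>s. drift \<gamma> b (X s \<omega>) (X s \<omega>) i) \<and>
        X t \<omega> $ i = X 0 \<omega> $ i
          + (LBINT s:{0..t}. drift \<gamma> b (X s \<omega>) (X s \<omega>) i)
          + (\<Sum>j\<in>UNIV. \<sigma> i j * (W t \<omega> $ j - W 0 \<omega> $ j))"
      using sol by (simp add: strong_solution_def)
    then show ?thesis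
      by eventually_elim (intro ballI sde_vector_form; blast)
  qed

  \<comment> \<open>Dyadic times suffice by continuity, and they make \<open>P N\<close> a countable conjunction of
     measurable conditions.\<close>
  define P where "P N \<omega> \<longleftrightarrow>
      (\<forall>m k. k \<le> 2 ^ m \<longrightarrow> X (grid T (2 ^ m) k) \<omega> \<in> well_separated N) \<and>
      (\<forall>m\<ge>1. \<forall>k<2 ^ m. norm (W (grid T (2 ^ m) (Suc k)) \<omega> - W (grid T (2 ^ m) k) \<omega>)
          \<le> real N * sqrt (real m / 2 ^ m))" for N \<omega>
  define \<kappa> where "\<kappa> \<omega> = (LEAST N. P N \<omega>)" for \<omega>
  have W_dyadic: "AE \<omega> in M. \<exists>N::nat. \<forall>m\<ge>1. \<forall>k<2 ^ m.
      norm (W (grid T (2 ^ m) (Suc k)) \<omega> - W (grid T (2 ^ m) k) \<omega>) \<le> real N * sqrt (real m / 2 ^ m)"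
    by (rule brownian_motion_dyadic_increments[OF assms(3,5) T W_meas])
  have "AE \<omega> in M. \<exists>N. P N \<omega>"
    using X_cont W_dyadic
  proof eventually_elim
    case (elim \<omega>)
    have "compact ((\<lambda>t. X t \<omega>) ` {0..T})"
      using elim by (intro compact_continuous_image) auto
    moreover have "(\<lambda>t. X t \<omega>) ` {0..T} \<subseteq> weyl_chamber" using elim by auto
    ultimately obtain N1 where N1: "(\<lambda>t. X t \<omega>) ` {0..T} \<subseteq> well_separated N1"
      using compact_subset_well_separated by blast
    obtain N2 where N2: "\<forall>m\<ge>1. \<forall>k<2 ^ m.
      norm (W (grid T (2 ^ m) (Suc k)) \<omega> - W (grid T (2 ^ m) k) \<omega>) \<le> real N2 * sqrt (real m / 2 ^ m)"
      using elim by blast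
    have "well_separated N1 \<subseteq> (well_separated (max N1 N2) :: (real ^ 'd::{finite,linorder}) set)"
      by (rule well_separated_mono) simp
    moreover have "real N2 * sqrt (real m / 2 ^ m) \<le> real (max N1 N2) * sqrt (real m / 2 ^ m)" for m
      by (intro mult_right_mono) auto
    moreover have "X (grid T (2 ^ m) k) \<omega> \<in> well_separated N1" if "k \<le> 2 ^ m" for m k
      using N1 grid_mem[of T k "2 ^ m"] that T by auto
    ultimately have "P (max N1 N2) \<omega>"
      unfolding P_def using N2 by (blast intro: order_trans)
    then show ?case ..
  qed
  then have P_\<kappa>: "AE \<omega> in M. P (\<kappa> \<omega>) \<omega>"
    by eventually_elim (auto simp: \<kappa>_def intro: LeastI)
  have P_meas: "Measurable.pred M (P N)" for N
  proof -
    have [measurable]: "well_separated N \<in> sets (borel :: (real ^ 'd::{finite,linorder}) measure)"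
      by (intro borel_closed closed_well_separated)
    have "Measurable.pred M (\<lambda>\<omega>. X (grid T (2 ^ m) k) \<omega> \<in> well_separated N)" if "k \<le> 2 ^ m" for m k
    proof -
      have [measurable]: "X (grid T (2 ^ m) k) \<in> borel_measurable M"
        using grid_mem[of T k "2 ^ m"] that T by (intro X_meas) auto
      show ?thesis by measurable
    qed
    moreover have "Measurable.pred M (\<lambda>\<omega>. norm (W (grid T (2 ^ m) (Suc k)) \<omega> - W (grid T (2 ^ m) k) \<omega>)
        \<le> real N * sqrt (real m / 2 ^ m))" for m k
    proof -
      have [measurable]: "W (grid T (2 ^ m) l) \<in> borel_measurable M" for l
        using T by (intro W_meas) (simp add: grid_def)
      show ?thesis by measurable
    qed
    ultimately show ?thesis
      unfolding P_def by (intro pred_intros_logic pred_intros_countable pred_intros_imp') auto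
  qed
  have \<kappa>_meas: "\<kappa> \<in> measurable M (count_space UNIV)"
    unfolding \<kappa>_def using P_meas by (rule measurable_Least)

  have "\<forall>N. \<exists>c. convergence_constant T \<gamma> b \<sigma> N c"
    by (intro allI pathwise_convergence_rate T assms(7,8))
  from choice[OF this] obtain c where c: "\<forall>N. convergence_constant T \<gamma> b \<sigma> N (c N)" ..
  show ?thesis
  proof (intro exI conjI allI impI)
    show "(\<lambda>\<omega>. c (\<kappa> \<omega>)) \<in> borel_measurable M"
      by (rule measurable_compose[OF \<kappa>_meas]) simp
    fix n :: nat assume n: "n \<ge> 2"
    have "AE \<omega> in M. Xn n 0 \<omega> = X 0 \<omega> \<and>
        (\<forall>k<n. Xn n (Suc k) \<omega> \<in> weyl_chamber \<and>
          (\<forall>i. Xn n (Suc k) \<omega> $ i = Xn n k \<omega> $ i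
             + drift \<gamma> b (Xn n (Suc k) \<omega>) (Xn n k \<omega>) i * (T / real n)
             + (\<Sum>j\<in>UNIV. \<sigma> i j * (W (grid T n (Suc k)) \<omega> $ j - W (grid T n k) \<omega> $ j))))"
      using assms(10)[of n] n by (simp add: semi_implicit_EM_def)
    then show "AE \<omega> in M. (SUP k\<in>{1..n}. norm (X (grid T n k) \<omega> - Xn n k \<omega>))
        \<le> sqrt (ln (real n)) / sqrt (real n) * c (\<kappa> \<omega>)"
      using W_cont X_cont X_eq P_\<kappa>
    proof eventually_elim
      case (elim \<omega>)
      have room: "\<forall>t\<in>{0..T}. X t \<omega> \<in> well_separated (\<kappa> \<omega>)"
      proof
        fix t assume t: "t \<in> {0..T}"
        show "X t \<omega> \<in> well_separated (\<kappa> \<omega>)"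
          by (rule path_in_closed_of_dyadic[OF T closed_well_separated conjunct1[OF elim(3)] _ t])
            (use elim(5) in \<open>simp add: P_def\<close>)
      qed
      have Z: "\<forall>k<n. Xn n (Suc k) \<omega> \<in> weyl_chamber \<and>
          Xn n (Suc k) \<omega> = Xn n k \<omega> + (T / real n) *\<^sub>R (repulsion \<gamma> (Xn n (Suc k) \<omega>) + regular_drift b (Xn n k \<omega>))
            + (\<chi> i j. \<sigma> i j) *v (W (grid T n (Suc k)) \<omega> - W (grid T n k) \<omega>)"
      proof (intro allI impI conjI)
        fix k assume k: "k < n"
        show "Xn n (Suc k) \<omega> \<in> weyl_chamber" using elim(1) k by blast
        show "Xn n (Suc k) \<omega> = Xn n k \<omega> + (T / real n) *\<^sub>R (repulsion \<gamma> (Xn n (Suc k) \<omega>) + regular_drift b (Xn n k \<omega>))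
            + (\<chi> i j. \<sigma> i j) *v (W (grid T n (Suc k)) \<omega> - W (grid T n k) \<omega>)"
        proof (subst vec_eq_iff, rule allI)
          fix i
          have "Xn n (Suc k) \<omega> $ i = Xn n k \<omega> $ i
             + drift \<gamma> b (Xn n (Suc k) \<omega>) (Xn n k \<omega>) i * (T / real n)
             + (\<Sum>j\<in>UNIV. \<sigma> i j * (W (grid T n (Suc k)) \<omega> $ j - W (grid T n k) \<omega> $ j))"
            using elim(1) k by blast
          then show "Xn n (Suc k) \<omega> $ i = (Xn n k \<omega>
              + (T / real n) *\<^sub>R (repulsion \<gamma> (Xn n (Suc k) \<omega>) + regular_drift b (Xn n k \<omega>))
              + (\<chi> i j. \<sigma> i j) *v (W (grid T n (Suc k)) \<omega> - W (grid T n k) \<omega>)) $ i"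
            by (simp add: drift_eq matrix_vector_mult_def mult.commute)
        qed
      qed
      have "\<forall>k\<le>n. norm (X (grid T n k) \<omega> - Xn n k \<omega>) \<le> sqrt (ln (real n)) / sqrt (real n) * c (\<kappa> \<omega>)"
        by (rule convergence_constantD[OF c[rule_format], where x = "\<lambda>t. X t \<omega>" and w = "\<lambda>t. W t \<omega>" and Z = "\<lambda>k. Xn n k \<omega>"])
          (fact conjunct1[OF elim(3)] room elim(2) conjunct2[OF elim(5)[unfolded P_def]] elim(4) n conjunct1[OF elim(1)] Z)+
      then show ?case
        using n by (intro cSUP_least) auto
    qed
  qed
qed

end
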